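(* Let $\beta\ge 2$ be a fixed integer. For the MST problem under explorable uncertainty with predictions, there is no deterministic $\beta$-robust algorithm that is $\alpha$-consistent for some $\alpha<1+\frac{1}{\beta}$. Conversely, no deterministic $\alpha$-consistent algorithm with $\alpha>1$ is $\beta$-robust for any $\beta<\max\left\{\frac{1}{\alpha-1},2\right\}$.
   Context: MST problem under explorable uncertainty with predictions: an instance is a connected (multi)graph $G=(V,E)$. Each edge $e$ has an unknown true weight $w_e\in\mathbb{R}_+$ and a known uncertainty interval $I_e$, either an open interval $(L_e,U_e)$ containing $w_e$ or the trivial interval $\{w_e\}$. Querying an edge reveals $w_e$. A set $Q\subseteq E$ is a feasible query set if there is a spanning tree $T$ that is a minimum spanning tree for every weight assignment that equals $w_e$ for $e\in Q$ and takes arbitrary values in $I_e$ for $e\notin Q$. $\mathrm{OPT}$ is a feasible query set of minimum cardinality. An algorithm queries edges adaptively (true values may be chosen adversarially) until its query set $\mathrm{ALG}$ is feasible; it receives a prediction $\hat w_e\in I_e$ for every edge. It is $\rho$-competitive if $|\mathrm{ALG}|\le\rho|\mathrm{OPT}|$ on every instance; $\alpha$-consistent if $\alpha$-competitive on instances with all predictions correct ($\hat w_e=w_e$ for all $e$); $\beta$-robust if $\beta$-competitive on all instances regardless of predictions. *)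

theory Defs
  imports Complex_Main
begin

section \<open>Instances\<close>

text \<open>
  What an algorithm knows at the start: a multigraph (several edges may have the same two
  ends), the uncertainty interval and the predicted weight of every edge. The true weights are
  a separate argument \<open>w\<close> of the definitions below. Values of the fields and of \<open>w\<close> outside the
  edge set are irrelevant.

  The AFP entry Graph\_Theory is not used: its trees are digraphs without directed cycles, so
  that an undirected cycle may count as a tree, depending on how its edges are oriented.
\<close>

record ('v, 'e) mst_input =
  verts :: "'v set"
  edges :: "'e set"
  ends :: "'e \<Rightarrow> 'v set"
  interval :: "'e \<Rightarrow> real set"
  prediction :: "'e \<Rightarrow> real"

definition spans :: "('v, 'e) mst_input \<Rightarrow> 'e set \<Rightarrow> bool" where
  "spans I T \<longleftrightarrow> (\<forall>u\<in>verts I. \<forall>v\<in>verts I. (u, v) \<in> {(x, y). \<exists>e\<in>T. ends I e = {x, y}}\<^sup>*)"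

text \<open>
  The list \<open>es\<close> is the edge sequence of a cycle visiting the distinct vertices \<open>vs\<close> in this
  order. Two parallel edges form a cycle of length 2.
\<close>

definition is_cycle :: "('v, 'e) mst_input \<Rightarrow> 'v list \<Rightarrow> 'e list \<Rightarrow> bool" where
  "is_cycle I vs es \<longleftrightarrow>
     es \<noteq> [] \<and> length vs = length es \<and> distinct vs \<and> distinct es \<and>
     (\<forall>i<length es. ends I (es ! i) = {vs ! i, vs ! (Suc i mod length vs)})"

definition spanning_tree :: "('v, 'e) mst_input \<Rightarrow> 'e set \<Rightarrow> bool" where
  "spanning_tree I T \<longleftrightarrow>
     T \<subseteq> edges I \<and> spans I T \<and> (\<nexists>vs es. is_cycle I vs es \<and> set es \<subseteq> T)"

definition minimum_spanning_tree ::
    "('v, 'e) mst_input \<Rightarrow> ('e \<Rightarrow> real) \<Rightarrow> 'e set \<Rightarrow> bool" where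
  "minimum_spanning_tree I w T \<longleftrightarrow>
     spanning_tree I T \<and> (\<forall>T'. spanning_tree I T' \<longrightarrow> sum w T \<le> sum w T')"

definition mst_instance :: "('v, 'e) mst_input \<Rightarrow> ('e \<Rightarrow> real) \<Rightarrow> bool" where
  "mst_instance I w \<longleftrightarrow>
     finite (verts I) \<and> verts I \<noteq> {} \<and> finite (edges I) \<and>
     (\<forall>e\<in>edges I. ends I e \<subseteq> verts I \<and> card (ends I e) = 2) \<and>
     spans I (edges I) \<and>
     (\<forall>e\<in>edges I.
        (interval I e = {w e} \<or> (\<exists>L U. interval I e = {L<..<U})) \<and>
        interval I e \<subseteq> {0..} \<and> w e \<in> interval I e \<and> prediction I e \<in> interval I e)"

section \<open>Feasible query sets\<close>

definition feasible :: "('v, 'e) mst_input \<Rightarrow> ('e \<Rightarrow> real) \<Rightarrow> 'e set \<Rightarrow> bool" where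
  "feasible I w Q \<longleftrightarrow>
     (\<exists>T. spanning_tree I T \<and>
        (\<forall>w'. (\<forall>e\<in>edges I. if e \<in> Q then w' e = w e else w' e \<in> interval I e) \<longrightarrow>
           minimum_spanning_tree I w' T))"

definition opt :: "('v, 'e) mst_input \<Rightarrow> ('e \<Rightarrow> real) \<Rightarrow> nat" where
  "opt I w = (LEAST k. \<exists>Q\<subseteq>edges I. feasible I w Q \<and> card Q = k)"

section \<open>Deterministic algorithms\<close>

text \<open>
  A deterministic adaptive algorithm maps the input and the sequence of queries made so far,
  together with the weights they revealed, to the next edge to query. With natural numbers for
  \<open>'v\<close> and \<open>'e\<close>, every finite multigraph occurs among the inputs up to isomorphism.
\<close>

type_synonym ('v, 'e) strategy = "('v, 'e) mst_input \<Rightarrow> ('e \<times> real) list \<Rightarrow> 'e"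

primrec history ::
    "('v, 'e) strategy \<Rightarrow> ('v, 'e) mst_input \<Rightarrow> ('e \<Rightarrow> real) \<Rightarrow> nat \<Rightarrow> ('e \<times> real) list" where
  "history A I w 0 = []"
| "history A I w (Suc n) =
     (let h = history A I w n; e = A I h in h @ [(e, w e)])"

definition queried ::
    "('v, 'e) strategy \<Rightarrow> ('v, 'e) mst_input \<Rightarrow> ('e \<Rightarrow> real) \<Rightarrow> nat \<Rightarrow> 'e set" where
  "queried A I w n = fst ` set (history A I w n)"

text \<open>
  As long as the query set is not feasible, the algorithm must query an edge not queried
  before. Its choices after that point are never used.
\<close>

definition deterministic_algorithm :: "('v, 'e) strategy \<Rightarrow> bool" where
  "deterministic_algorithm A \<longleftrightarrow>
     (\<forall>I w n. mst_instance I w \<longrightarrow> \<not> feasible I w (queried A I w n) \<longrightarrow>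
        A I (history A I w n) \<in> edges I - queried A I w n)"

definition alg ::
    "('v, 'e) strategy \<Rightarrow> ('v, 'e) mst_input \<Rightarrow> ('e \<Rightarrow> real) \<Rightarrow> 'e set" where
  "alg A I w = queried A I w (LEAST n. feasible I w (queried A I w n))"

definition robust :: "real \<Rightarrow> ('v, 'e) strategy \<Rightarrow> bool" where
  "robust \<beta> A \<longleftrightarrow>
     (\<forall>I w. mst_instance I w \<longrightarrow> real (card (alg A I w)) \<le> \<beta> * real (opt I w))"

definition consistent :: "real \<Rightarrow> ('v, 'e) strategy \<Rightarrow> bool" where
  "consistent \<alpha> A \<longleftrightarrow>
     (\<forall>I w. mst_instance I w \<longrightarrow> (\<forall>e\<in>edges I. prediction I e = w e) \<longrightarrow>
        real (card (alg A I w)) \<le> \<alpha> * real (opt I w))"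

section \<open>The least elements in \<^term>\<open>opt\<close> and \<^term>\<open>alg\<close> exist\<close>

lemma spanning_tree_exists:
  assumes "mst_instance I w"
  shows "\<exists>T. spanning_tree I T"
proof -
  let ?R = "\<lambda>T. {(x, y). \<exists>e\<in>T. ends I e = {x, y}}"
  define P where "P = (\<lambda>T. T \<subseteq> edges I \<and> spans I T)"
  have fin: "finite (edges I)" and "P (edges I)"
    using assms by (auto simp: mst_instance_def P_def)
  then obtain T where T: "P T" and min: "\<And>T'. P T' \<Longrightarrow> card T \<le> card T'"
    using ex_has_least_nat[of P "edges I" card] by blast
  have "\<not> (is_cycle I vs es \<and> set es \<subseteq> T)" for vs es
  proof
    assume c: "is_cycle I vs es \<and> set es \<subseteq> T"
    define m where "m = length es"
    define e where "e = es ! (m - 1)"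
    define T' where "T' = T - {e}"
    have m: "m > 0" "length vs = m" and d: "distinct es"
      and en: "\<And>i. i < m \<Longrightarrow> ends I (es ! i) = {vs ! i, vs ! (Suc i mod m)}"
      using c by (auto simp: is_cycle_def m_def)
    have eT: "e \<in> T"
      using c m by (auto simp: e_def m_def)
    have path: "(vs ! 0, vs ! i) \<in> (?R T')\<^sup>*" if "i < m" for i
      using that
    proof (induction i)
      case (Suc i)
      have "es ! i \<noteq> e"
        using Suc.prems d by (auto simp: e_def m_def nth_eq_iff_index_eq)
      moreover have "es ! i \<in> T"
        using c Suc.prems by (auto simp: m_def)
      ultimately have "(vs ! i, vs ! Suc i) \<in> ?R T'"
        using en[of i] Suc.prems by (auto simp: T'_def)
      then show ?case
        using Suc by (auto intro: rtrancl_into_rtrancl)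
    qed simp
    have "sym (?R T')"
      by (auto simp: sym_def insert_commute)
    then have sy: "(a, b) \<in> (?R T')\<^sup>* \<Longrightarrow> (b, a) \<in> (?R T')\<^sup>*" for a b
      by (meson sym_rtrancl symD)
    have ee: "ends I e = {vs ! (m - 1), vs ! 0}"
      using en[of "m - 1"] m by (simp add: e_def)
    have "?R T \<subseteq> (?R T')\<^sup>*"
    proof clarify
      fix x y f assume f: "f \<in> T" "ends I f = {x, y}"
      show "(x, y) \<in> (?R T')\<^sup>*"
      proof (cases "f = e")
        case True
        then have "x = vs ! (m - 1) \<and> y = vs ! 0 \<or> x = vs ! 0 \<and> y = vs ! (m - 1)"
          using ee f by (auto simp: doubleton_eq_iff)
        then show ?thesis
          using path[of "m - 1"] sy m by auto
      next
        case False
        then show ?thesis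
          using f by (auto simp: T'_def)
      qed
    qed
    then have "(?R T)\<^sup>* \<subseteq> (?R T')\<^sup>*"
      by (rule rtrancl_subset_rtrancl)
    then have "P T'"
      using T by (auto simp: P_def spans_def T'_def)
    moreover have "card T' < card T"
      using eT T fin finite_subset[of T "edges I"] unfolding T'_def P_def
      by (intro card_Diff1_less) auto
    ultimately show False
      using min[of T'] by simp
  qed
  then show ?thesis
    using T by (auto simp: spanning_tree_def P_def)
qed

lemma feasible_edges:
  assumes "mst_instance I w"
  shows "feasible I w (edges I)"
proof -
  have fin: "finite {T. spanning_tree I T}"
    by (rule finite_subset[of _ "Pow (edges I)"])
      (use assms in \<open>auto simp: spanning_tree_def mst_instance_def\<close>)
  obtain T where T: "spanning_tree I T"
      and min: "\<And>T'. spanning_tree I T' \<Longrightarrow> sum w T \<le> sum w T'"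
    using ex_is_arg_min_if_finite[OF fin, of "sum w"] spanning_tree_exists[OF assms]
    unfolding is_arg_min_def by (metis empty_iff mem_Collect_eq not_le)
  have eq: "sum w' S = sum w S"
    if "\<forall>e\<in>edges I. w' e = w e" "spanning_tree I S" for w' S
    using that by (intro sum.cong) (auto simp: spanning_tree_def)
  have "minimum_spanning_tree I w' T" if "\<forall>e\<in>edges I. w' e = w e" for w'
    unfolding minimum_spanning_tree_def
  proof (intro conjI allI impI)
    fix T' assume "spanning_tree I T'"
    then show "sum w' T \<le> sum w' T'"
      using min[of T'] eq[OF that T] eq[OF that, of T'] by simp
  qed (rule T)
  moreover have "\<forall>e\<in>edges I. w' e = w e"
    if "\<forall>e\<in>edges I. if e \<in> edges I then w' e = w e else w' e \<in> interval I e" for w'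
    using that by simp
  ultimately show ?thesis
    unfolding feasible_def using T by blast
qed

lemma algorithm_terminates:
  assumes "deterministic_algorithm A" "mst_instance I w"
  shows "\<exists>n. feasible I w (queried A I w n)"
proof (rule ccontr)
  assume "\<nexists>n. feasible I w (queried A I w n)"
  then have nf: "\<not> feasible I w (queried A I w n)" for n
    by blast
  have new: "A I (history A I w n) \<in> edges I - queried A I w n" for n
    using assms nf by (auto simp: deterministic_algorithm_def)
  have fin: "finite (edges I)"
    using assms by (simp add: mst_instance_def)
  have step: "queried A I w (Suc n) = insert (A I (history A I w n)) (queried A I w n)" for n
    by (simp add: queried_def Let_def)
  have sub: "queried A I w n \<subseteq> edges I" for n
  proof (induction n)
    case (Suc n)
    then show ?case using new[of n] by (auto simp: step)
  qed (simp add: queried_def)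
  have "card (queried A I w n) = n" for n
  proof (induction n)
    case (Suc n)
    then show ?case
      using new[of n] finite_subset[OF sub[of n] fin] by (simp add: step)
  qed (simp add: queried_def)
  then show False
    using card_mono[OF fin sub[of "Suc (card (edges I))"]] by simp
qed

end

theory Submission
  imports Defs
begin

text \<open>
  Take two vertices joined by \<open>b + 1\<close> parallel edges, so that a minimum spanning tree is a
  cheapest edge. Edge \<open>0\<close> has interval \<open>(0, 2)\<close>, the edges \<open>1, \<dots>, b\<close> have interval \<open>(1, 3)\<close>;
  the predictions are \<open>3/2\<close> and \<open>5/2\<close>. If the predictions are correct, the feasible sets are
  those containing \<open>1, \<dots>, b\<close>, so an algorithm that also queries edge \<open>0\<close> pays \<open>b + 1\<close> against
  an optimum of \<open>b\<close>. If it does not query edge \<open>0\<close>, let \<open>j\<close> be the last edge it queries and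
  change the weights of \<open>j\<close> and \<open>0\<close> to \<open>3/2\<close> and \<open>1/2\<close>: the run is unchanged until \<open>j\<close> is
  queried, afterwards edge \<open>0\<close> must be queried as well, but edge \<open>0\<close> alone would have sufficed.
  The bound \<open>2\<close> on the robustness is the case \<open>b = 1\<close>.
\<close>

section \<open>Runs of an algorithm\<close>

lemma queried_Suc:
  "queried A I w (Suc n) = insert (A I (history A I w n)) (queried A I w n)"
  by (simp add: queried_def Let_def)

text \<open>A strategy sees a weight only after querying its edge, so an adversary may still change
  the weights that the first \<open>n\<close> queries miss.\<close>

lemma history_cong:
  assumes "\<forall>e\<in>queried A I w n. w e = w' e"
  shows "history A I w n = history A I w' n"
  using assms
proof (induction n)
  case (Suc n)
  have "history A I w n = history A I w' n"
    by (rule Suc.IH) (use Suc.prems in \<open>unfold queried_Suc, blast\<close>)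
  moreover have "w (A I (history A I w n)) = w' (A I (history A I w n))"
    using Suc.prems unfolding queried_Suc by blast
  ultimately show ?case
    by (simp add: Let_def)
qed simp

lemma queried_mono:
  assumes "m \<le> n"
  shows "queried A I w m \<subseteq> queried A I w n"
  using assms by (induction rule: dec_induct) (auto simp: queried_Suc)

lemma finite_alg: "finite (alg A I w)"
  by (simp add: alg_def queried_def)

lemma feasible_alg:
  assumes "deterministic_algorithm A" "mst_instance I w"
  shows "feasible I w (alg A I w)"
  unfolding alg_def by (rule LeastI_ex) (rule algorithm_terminates[OF assms])

lemma opt_le_card:
  assumes "feasible I w Q" "Q \<subseteq> edges I"
  shows "opt I w \<le> card Q"
  unfolding opt_def by (rule Least_le) (use assms in blast)

section \<open>Spanning trees and feasible query sets of parallel edges\<close>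

definition parallel_edges :: "nat \<Rightarrow> (nat, nat) mst_input" where
  "parallel_edges b = \<lparr>verts = {0, 1}, edges = {..b}, ends = (\<lambda>_. {0, 1}),
     interval = (\<lambda>e. if e = 0 then {0<..<2} else {1<..<3}),
     prediction = (\<lambda>e. if e = 0 then 3/2 else 5/2)\<rparr>"

lemma parallel_edges_sel [simp]:
  "verts (parallel_edges b) = {0, 1}" "edges (parallel_edges b) = {..b}" "ends (parallel_edges b) e = {0, 1}"
  "interval (parallel_edges b) e = (if e = 0 then {0<..<2} else {1<..<3})"
  "prediction (parallel_edges b) e = (if e = 0 then 3/2 else 5/2)"
  by (simp_all add: parallel_edges_def)

lemma spans_parallel_edges_iff: "spans (parallel_edges b) T \<longleftrightarrow> T \<noteq> {}"
proof
  assume "spans (parallel_edges b) T"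
  then show "T \<noteq> {}"
    by (auto simp: spans_def)
next
  assume "T \<noteq> {}"
  then have "(0, 1) \<in> {(x, y). \<exists>e\<in>T. ends (parallel_edges b) e = {x, y}}"
    "(1, 0) \<in> {(x, y). \<exists>e\<in>T. ends (parallel_edges b) e = {x, y}}"
    by auto
  then show "spans (parallel_edges b) T"
    unfolding spans_def by (auto intro: r_into_rtrancl)
qed

lemma spanning_tree_parallel_edges_iff: "spanning_tree (parallel_edges b) T \<longleftrightarrow> (\<exists>e\<le>b. T = {e})"
proof
  assume T: "spanning_tree (parallel_edges b) T"
  then obtain e where e: "e \<in> T" "T \<subseteq> {..b}"
    by (auto simp: spanning_tree_def spans_parallel_edges_iff)
  have "f = e" if "f \<in> T" for f
  proof (rule ccontr)
    assume "f \<noteq> e"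
    then have "is_cycle (parallel_edges b) [0, 1] [e, f]"
      by (auto simp: is_cycle_def less_Suc_eq insert_commute)
    moreover have "set [e, f] \<subseteq> T"
      using e that by simp
    ultimately show False
      using T unfolding spanning_tree_def by blast
  qed
  with e show "\<exists>e\<le>b. T = {e}"
    by blast
next
  assume "\<exists>e\<le>b. T = {e}"
  then obtain e where e: "e \<le> b" "T = {e}"
    by blast
  have "\<not> is_cycle (parallel_edges b) vs es" if es: "set es \<subseteq> {e}" for vs es
  proof
    assume c: "is_cycle (parallel_edges b) vs es"
    then have "length es = card (set es)" "es \<noteq> []"
      by (simp_all add: is_cycle_def distinct_card)
    moreover have "card (set es) \<le> 1"
      using card_mono[OF _ es] by simp
    ultimately have "length es = 1"
      by (simp add: le_Suc_eq)
    \<comment> \<open>In a cycle of length 1 the successor index wraps around to \<open>0\<close>,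
      so its edge would be a loop.\<close>
    with c have "{0, 1} = {vs ! 0, vs ! 0}"
      by (simp add: is_cycle_def)
    then show False
      by (auto simp: doubleton_eq_iff)
  qed
  with e show "spanning_tree (parallel_edges b) T"
    by (auto simp: spanning_tree_def spans_parallel_edges_iff)
qed

text \<open>Spanning trees are single edges, so one fixed edge has to be cheapest under every
  realization that agrees with the revealed weights.\<close>

lemma feasible_parallel_edges_iff:
  "feasible (parallel_edges b) w Q \<longleftrightarrow>
     (\<exists>e\<le>b. \<forall>w'. (\<forall>f\<le>b. if f \<in> Q then w' f = w f else w' f \<in> interval (parallel_edges b) f) \<longrightarrow>
        (\<forall>f\<le>b. w' e \<le> w' f))"
proof -
  have "minimum_spanning_tree (parallel_edges b) w' {e} \<longleftrightarrow> (\<forall>f\<le>b. w' e \<le> w' f)" if "e \<le> b" for w' e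
  proof -
    have "(\<forall>T'. (\<exists>f\<le>b. T' = {f}) \<longrightarrow> sum w' {e} \<le> sum w' T') \<longleftrightarrow> (\<forall>f\<le>b. sum w' {e} \<le> sum w' {f})"
      by blast
    with that show ?thesis
      by (auto simp: minimum_spanning_tree_def spanning_tree_parallel_edges_iff)
  qed
  moreover have "feasible (parallel_edges b) w Q \<longleftrightarrow>
     (\<exists>e\<le>b. \<forall>w'. (\<forall>f\<le>b. if f \<in> Q then w' f = w f else w' f \<in> interval (parallel_edges b) f) \<longrightarrow>
        minimum_spanning_tree (parallel_edges b) w' {e})"
    unfolding feasible_def spanning_tree_parallel_edges_iff parallel_edges_sel(2) Ball_def atMost_iff
    by blast
  ultimately show ?thesis
    by (simp only: cong: conj_cong)
qed

lemma mst_instance_parallel_edges: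
  assumes "\<forall>e\<le>b. w e \<in> interval (parallel_edges b) e"
  shows "mst_instance (parallel_edges b) w"
proof -
  have "\<exists>L U. interval (parallel_edges b) e = {L<..<U}" for e
    by (cases "e = 0") auto
  then show ?thesis
    unfolding mst_instance_def using assms
    by (simp del: parallel_edges_sel(4) add: spans_parallel_edges_iff) (simp add: subset_iff)
qed

lemma feasible_parallel_edges_prediction:
  "feasible (parallel_edges b) (prediction (parallel_edges b)) {1..b}"
  unfolding feasible_parallel_edges_iff
proof (intro exI[of _ 0] conjI allI impI)
  fix w' :: "nat \<Rightarrow> real" and f
  assume w': "\<forall>f\<le>b. if f \<in> {1..b} then w' f = prediction (parallel_edges b) f
    else w' f \<in> interval (parallel_edges b) f" and "f \<le> b"
  \<comment> \<open>Edge \<open>0\<close> stays below 2, while every other edge has been revealed to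
    weigh 5/2.\<close>
  then show "w' 0 \<le> w' f"
    using w'[rule_format, of 0] w'[rule_format, of f] by (cases "f = 0") simp_all
qed simp

lemma feasible_parallel_edges_predictionD:
  assumes "feasible (parallel_edges b) (prediction (parallel_edges b)) Q" "i \<in> {1..b}"
  shows "i \<in> Q"
proof (rule ccontr)
  assume i: "i \<notin> Q"
  obtain e where e: "e \<le> b"
    and min: "\<And>w' f. \<lbrakk>\<forall>f\<le>b. if f \<in> Q then w' f = prediction (parallel_edges b) f
        else w' f \<in> interval (parallel_edges b) f; f \<le> b\<rbrakk> \<Longrightarrow> w' e \<le> w' f"
    using assms(1) unfolding feasible_parallel_edges_iff by blast
  show False
  proof (cases "e = 0")
    case True
    \<comment> \<open>An unqueried \<open>i\<close> may weigh as little as 5/4, which undercuts the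
      3/2 of edge \<open>0\<close>.\<close>
    have "((prediction (parallel_edges b))(i := 5/4)) e \<le> ((prediction (parallel_edges b))(i := 5/4)) i"
      by (rule min) (use i assms(2) in auto)
    with True assms(2) show False
      by simp
  next
    case False
    \<comment> \<open>The predictions themselves are a possible realization, and there edge
      \<open>0\<close> is strictly cheapest.\<close>
    have "prediction (parallel_edges b) e \<le> prediction (parallel_edges b) 0"
      by (rule min) auto
    with False show False
      by simp
  qed
qed

lemma feasible_parallel_edges_zero:
  assumes "w 0 \<le> 1"
  shows "feasible (parallel_edges b) w {0}"
  unfolding feasible_parallel_edges_iff
proof (intro exI[of _ 0] conjI allI impI)
  fix w' :: "nat \<Rightarrow> real" and f
  assume w': "\<forall>f\<le>b. if f \<in> {0} then w' f = w f
    else w' f \<in> interval (parallel_edges b) f" and "f \<le> b"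
  then show "w' 0 \<le> w' f"
    using assms w'[rule_format, of 0] w'[rule_format, of f] by (cases "f = 0") simp_all
qed simp

text \<open>While edge \<open>0\<close> is unqueried, its weight may lie above \<open>w j\<close> or
  below all other weights, so no edge is cheapest in both cases.\<close>

lemma zero_mem_feasible_parallel_edges:
  assumes "feasible (parallel_edges b) w Q" "\<forall>e\<le>b. w e \<in> interval (parallel_edges b) e"
    and "j \<in> {1..b}" "w j < 2"
  shows "0 \<in> Q"
proof (rule ccontr)
  assume Q: "0 \<notin> Q"
  obtain e where e: "e \<le> b"
    and min: "\<And>w' f. \<lbrakk>\<forall>f\<le>b. if f \<in> Q then w' f = w f
        else w' f \<in> interval (parallel_edges b) f; f \<le> b\<rbrakk> \<Longrightarrow> w' e \<le> w' f"
    using assms(1) unfolding feasible_parallel_edges_iff by blast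
  have w: "1 < w f" if "f \<le> b" "f \<noteq> 0" for f
    using assms(2) that by auto
  show False
  proof (cases "e = 0")
    case True
    \<comment> \<open>The midpoint of \<open>w j\<close> and 2 exceeds \<open>w j\<close> and still
      lies in the interval of edge \<open>0\<close>.\<close>
    have "(w(0 := (w j + 2) / 2)) e \<le> (w(0 := (w j + 2) / 2)) j"
      by (rule min) (use assms(2-4) w[of j] Q in auto)
    with True assms(3,4) show False
      by simp
  next
    case False
    have "(w(0 := 1/2)) e \<le> (w(0 := 1/2)) 0"
      by (rule min) (use assms(2) Q in auto)
    with False w[OF e] show False
      by simp
  qed
qed

section \<open>The adversary argument\<close>

lemma parallel_edges_dichotomy:
  assumes A: "deterministic_algorithm A" and "robust \<gamma> A" and b: "b \<ge> 1"
  obtains "real b + 1 \<le> \<gamma>"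
  | "b + 1 \<le> card (alg A (parallel_edges b) (prediction (parallel_edges b)))"
    "opt (parallel_edges b) (prediction (parallel_edges b)) \<le> b"
proof -
  let ?I = "parallel_edges b"
  let ?w = "prediction ?I"
  have inst: "mst_instance ?I ?w"
    by (rule mst_instance_parallel_edges) simp
  have sub: "{1..b} \<subseteq> alg A ?I ?w"
    using feasible_parallel_edges_predictionD[OF feasible_alg[OF A inst]] by blast
  have card_ge: "b + 1 \<le> card (alg A ?I w)" if "insert 0 {1..b} \<subseteq> alg A ?I w" for w
    using card_mono[OF finite_alg that] by simp
  show thesis
  proof (cases "0 \<in> alg A ?I ?w")
    case True
    have "opt ?I ?w \<le> b"
      using opt_le_card[OF feasible_parallel_edges_prediction] by auto
    with True sub card_ge that(2) show ?thesis
      by simp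
  next
    case False
    define N where "N = (LEAST n. feasible ?I ?w (queried A ?I ?w n))"
    have alg: "alg A ?I ?w = queried A ?I ?w N"
      by (simp add: alg_def N_def)
    \<comment> \<open>As \<open>b \<ge> 1\<close>, some query is necessary, so there is a last one,
      \<open>j\<close>.\<close>
    have "N \<noteq> 0"
      using sub b unfolding alg by (metis atLeastAtMost_iff empty_iff history.simps(1) image_empty
          le_refl list.set(1) queried_def subsetD)
    then obtain m where m: "N = Suc m"
      using not0_implies_Suc by blast
    have nf: "\<not> feasible ?I ?w (queried A ?I ?w m)"
      using not_less_Least[of m "\<lambda>n. feasible ?I ?w (queried A ?I ?w n)"] m by (simp add: N_def)
    define j where "j = A ?I (history A ?I ?w m)"
    have "j \<in> edges ?I - queried A ?I ?w m"
      using A inst nf unfolding deterministic_algorithm_def j_def by blast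
    then have j: "j \<le> b" "j \<notin> queried A ?I ?w m"
      by simp_all
    have alg_Suc: "alg A ?I ?w = insert j (queried A ?I ?w m)"
      by (simp add: alg m queried_Suc j_def)
    have j0: "j \<noteq> 0" "0 \<notin> queried A ?I ?w m"
      using False alg_Suc by auto
    \<comment> \<open>Only weights unseen in the first \<open>m\<close> queries change. The value
      1/2 makes edge \<open>0\<close> alone sufficient; 3/2 is below 2, so every feasible set must
      contain edge \<open>0\<close>.\<close>
    define w' where "w' = ?w(0 := 1/2, j := 3/2)"
    have same: "history A ?I ?w m = history A ?I w' m"
      by (rule history_cong) (unfold w'_def, use j j0 in \<open>metis fun_upd_apply\<close>)
    \<comment> \<open>The choice of \<open>j\<close> precedes the revelation of its weight, so both
      runs make it.\<close>
    have alg_eq: "queried A ?I w' N = alg A ?I ?w"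
      unfolding alg m using same by (simp add: queried_def Let_def)
    have w': "\<forall>e\<le>b. w' e \<in> interval ?I e"
      using j0 by (auto simp: w'_def)
    then have inst': "mst_instance ?I w'"
      by (rule mst_instance_parallel_edges)
    have zero: "0 \<in> Q" if "feasible ?I w' Q" for Q
      by (rule zero_mem_feasible_parallel_edges[OF that w', of j]) (use j j0 in \<open>auto simp: w'_def\<close>)
    define N' where "N' = (LEAST n. feasible ?I w' (queried A ?I w' n))"
    have alg': "alg A ?I w' = queried A ?I w' N'"
      by (simp add: alg_def N'_def)
    have zero': "0 \<in> queried A ?I w' N'"
      using zero[OF feasible_alg[OF A inst']] by (simp add: alg')
    \<comment> \<open>The first \<open>N\<close> queries miss edge \<open>0\<close>, so the new run
      is longer and contains the old one.\<close>
    have "\<not> N' \<le> N"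
      using queried_mono[of N' N A ?I w'] zero' False alg_eq by auto
    then have "alg A ?I ?w \<subseteq> alg A ?I w'"
      using queried_mono[of N N' A ?I w'] by (simp add: alg_eq alg')
    then have "real (b + 1) \<le> card (alg A ?I w')"
      using card_ge[of w'] sub zero' alg' by fastforce
    also have "\<dots> \<le> \<gamma> * opt ?I w'"
      using assms(2) inst' by (simp add: robust_def)
    finally have le: "real (b + 1) \<le> \<gamma> * opt ?I w'" .
    have "opt ?I w' \<le> 1"
      using opt_le_card[OF feasible_parallel_edges_zero[of w' b]] j0 by (auto simp: w'_def)
    \<comment> \<open>The value 0 contradicts \<open>le\<close>; splitting cases avoids a sign
      condition on \<open>\<gamma>\<close>.\<close>
    then have "opt ?I w' = 0 \<or> opt ?I w' = 1"
      by linarith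
    with le that(1) show ?thesis
      by auto
  qed
qed

section \<open>Bounds on robustness and consistency\<close>

lemma robust_ge_2:
  assumes "deterministic_algorithm (A :: (nat, nat) strategy)" "robust \<gamma> A"
  shows "\<gamma> \<ge> 2"
proof (rule parallel_edges_dichotomy[OF assms, of 1])
  let ?I = "parallel_edges 1"
  assume *: "1 + 1 \<le> card (alg A ?I (prediction ?I))" "opt ?I (prediction ?I) \<le> 1"
  have "real (card (alg A ?I (prediction ?I))) \<le> \<gamma> * opt ?I (prediction ?I)"
    using assms(2) mst_instance_parallel_edges[of 1 "prediction ?I"] by (simp add: robust_def)
  moreover have "opt ?I (prediction ?I) = 0 \<or> opt ?I (prediction ?I) = 1"
    using *(2) by linarith
  ultimately show ?thesis
    using *(1) by auto
qed auto

text \<open>Paying \<open>b + 1\<close> against an optimum of at most \<open>b\<close> on correct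
  predictions violates the consistency bound, which leaves the other outcome of the
  dichotomy.\<close>

lemma robust_consistent_tradeoff:
  assumes "deterministic_algorithm (A :: (nat, nat) strategy)" "robust \<gamma> A" "consistent \<alpha> A"
    and b: "b \<ge> 1" and \<alpha>: "\<alpha> < 1 + 1 / real b"
  shows "\<gamma> \<ge> real b + 1"
proof (rule parallel_edges_dichotomy[OF assms(1,2) b])
  let ?I = "parallel_edges b"
  assume *: "b + 1 \<le> card (alg A ?I (prediction ?I))" "opt ?I (prediction ?I) \<le> b"
  have "real (card (alg A ?I (prediction ?I))) \<le> \<alpha> * opt ?I (prediction ?I)"
    using assms(3) mst_instance_parallel_edges[of b "prediction ?I"] by (simp add: consistent_def)
  \<comment> \<open>The factor \<open>max 0 \<alpha>\<close> keeps the product monotone in the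
    optimum even if \<open>\<alpha>\<close> is negative.\<close>
  also have "\<dots> \<le> max 0 \<alpha> * b"
    using *(2) by (intro mult_mono) auto
  also have "\<dots> < (1 + 1 / real b) * b"
    using \<alpha> b by (intro mult_strict_right_mono) (auto simp: add_pos_nonneg)
  also have "\<dots> = real b + 1"
    using b by (simp add: field_simps)
  finally show ?thesis
    using *(1) by linarith
qed

theorem theorem4p1:
  fixes \<beta> :: int
  assumes "\<beta> \<ge> 2"
  shows "(\<nexists>(A :: (nat, nat) strategy) (\<alpha> :: real).
            deterministic_algorithm A \<and> robust (of_int \<beta>) A \<and>
            consistent \<alpha> A \<and> \<alpha> < 1 + 1 / of_int \<beta>) \<and>
         (\<forall>\<alpha> :: real. \<alpha> > 1 \<longrightarrow>
            (\<nexists>(A :: (nat, nat) strategy) (\<gamma> :: real).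
               deterministic_algorithm A \<and> consistent \<alpha> A \<and>
               robust \<gamma> A \<and> \<gamma> < max (1 / (\<alpha> - 1)) 2))"
proof (intro conjI allI impI notI; elim exE conjE)
  fix A :: "(nat, nat) strategy" and \<alpha> :: real
  assume "deterministic_algorithm A" "robust (of_int \<beta>) A" "consistent \<alpha> A"
    "\<alpha> < 1 + 1 / of_int \<beta>"
  then show False
    using robust_consistent_tradeoff[of A "of_int \<beta>" \<alpha> "nat \<beta>"] assms by (simp add: Suc_le_eq)
next
  fix A :: "(nat, nat) strategy" and \<alpha> \<gamma> :: real
  assume A: "deterministic_algorithm A" "consistent \<alpha> A" "robust \<gamma> A"
    and \<alpha>: "\<alpha> > 1" and \<gamma>: "\<gamma> < max (1 / (\<alpha> - 1)) 2"
  have \<gamma>2: "\<gamma> \<ge> 2"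
    using robust_ge_2 A by blast
  \<comment> \<open>Rounding down gives \<open>1 / \<gamma> \<le> 1 / b\<close>, so the tradeoff
    applies, while \<open>\<gamma> < b + 1\<close> contradicts its conclusion.\<close>
  define b where "b = nat \<lfloor>\<gamma>\<rfloor>"
  have b: "real b \<le> \<gamma>" "\<gamma> < real b + 1" "b \<ge> 1"
    using \<gamma>2 unfolding b_def by linarith+
  have "\<gamma> < 1 / (\<alpha> - 1)"
    using \<gamma> \<gamma>2 by simp
  then have "\<alpha> - 1 < 1 / \<gamma>"
    using \<alpha> \<gamma>2 by (simp add: field_simps)
  also have "\<dots> \<le> 1 / real b"
    using b by (intro divide_left_mono) auto
  finally have "\<alpha> < 1 + 1 / real b"
    by simp
  then show False
    using robust_consistent_tradeoff[OF A(1,3,2) b(3)] b(2) by simp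
qed

end
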